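(* Let $x,y,z\in\mathcal S$ be pairwise distinct states satisfying $E(z^*(x,z))>E(z^*(x,y))$ and $z^*(x,z)\ne x$. Then there exist nonnegative constants $K(\beta)$, $\beta>0$, with $\sup_{\beta>0}K(\beta)<\infty$ such that $$\mathbb P_x(\tau_z<\tau_y)\le K(\beta)\,e^{-\beta(E(z^*(x,z))-E(z^*(x,y))-7\gamma_\beta)},$$ and the right-hand side tends to $0$ as $\beta\to\infty$.
   Context: **Setting.** $\mathcal S$ is a finite set and $E:\mathcal S\to\mathbb R$ satisfies $E(r)\neq E(s)$ for $r\ne s$. For each $\beta>0$, $X=(X_n)_{n\ge0}$ is a Markov chain on $\mathcal S$ with transition matrix $(p(r,s))_{r,s\in\mathcal S}$ (depending on $\beta$) and stationary distribution $\pi$ such that: (i) the chain is irreducible, $p(s,s)>0$, $p(r,s)>0\iff p(s,r)>0$, and the set of pairs with $p(r,s)>0$ does not depend on $\beta$; (ii) there are $\gamma_\beta>0$ with $\gamma_\beta\to0$, $\beta\gamma_\beta\to\infty$ as $\beta\to\infty$ and $e^{-\beta((E(s)-E(r))^++\gamma_\beta/|\mathcal S|)}\le p(r,s)\le e^{-\beta((E(s)-E(r))^+-\gamma_\beta/|\mathcal S|)}$ for all distinct $r,s$ with $p(r,s)>0$; (iii) $p^*(r,s):=\lim_{\beta\to\infty}p(r,s)$ exists for all $r,s$ and, for pairs with $p(r,s)>0$, is positive if $E(r)\ge E(s)$ and $0$ otherwise; (iv) $\pi(r)p(r,s)=\pi(s)p(s,r)$. $\mathbb P_x$ refers to the chain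 started at $x$; $\tau_x:=\inf\{n\ge1:X_n=x\}$. **Essential saddles.** For $r\neq s$, $\Gamma(r,s)$ is the set of self-avoiding paths $(\gamma_0,\dots,\gamma_k)$ with $\gamma_0=r$, $\gamma_k=s$, $p(\gamma_l,\gamma_{l+1})>0$. A path in $\Gamma(r,s)$ is minimal if its maximal energy $\max_l E(\gamma_l)$ is minimal within $\Gamma(r,s)$. The essential saddle $z^*(r,s)$ is the state of maximal energy on any minimal path from $r$ to $s$ (well defined since $E$ is injective). *)

theory Defs
  imports "HOL-Probability.Probability"
begin

text \<open>
  The finite state space is a type \<open>'s\<close> of class \<open>finite\<close>, so that its cardinality is \<open>CARD('s)\<close>.
  A transition matrix is a function \<open>'s \<Rightarrow> 's \<Rightarrow> real\<close>, and objects depending on the inverse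
  temperature take it as their first argument; only its positive values are relevant.
\<close>

definition stochastic :: "('s::finite \<Rightarrow> 's \<Rightarrow> real) \<Rightarrow> bool" where
  "stochastic q \<longleftrightarrow> (\<forall>r s. 0 \<le> q r s) \<and> (\<forall>r. (\<Sum>s\<in>UNIV. q r s) = 1)"

fun n_step :: "('s::finite \<Rightarrow> 's \<Rightarrow> real) \<Rightarrow> nat \<Rightarrow> 's \<Rightarrow> 's \<Rightarrow> real" where
  "n_step q 0 r s = (if r = s then 1 else 0)"
| "n_step q (Suc n) r s = (\<Sum>t\<in>UNIV. q r t * n_step q n t s)"

definition irreducible_chain :: "('s::finite \<Rightarrow> 's \<Rightarrow> real) \<Rightarrow> bool" where
  "irreducible_chain q \<longleftrightarrow> (\<forall>r s. \<exists>n. n_step q n r s > 0)"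

definition stationary_distribution :: "('s::finite \<Rightarrow> 's \<Rightarrow> real) \<Rightarrow> ('s \<Rightarrow> real) \<Rightarrow> bool" where
  "stationary_distribution q \<mu> \<longleftrightarrow>
     (\<forall>s. 0 \<le> \<mu> s) \<and> (\<Sum>s\<in>UNIV. \<mu> s) = 1 \<and> (\<forall>s. (\<Sum>r\<in>UNIV. \<mu> r * q r s) = \<mu> s)"

text \<open>
  The last clause is the Markov property
  \<open>P (X (n+1) = a (n+1) | X 0 = a 0, \<dots>, X n = a n) = q (a n) (a (n+1))\<close>
  multiplied by the probability of the conditioning event, which may be zero.
\<close>

definition markov_chain_from ::
    "('s::finite \<Rightarrow> 's \<Rightarrow> real) \<Rightarrow> 's \<Rightarrow> 'w measure \<Rightarrow> (nat \<Rightarrow> 'w \<Rightarrow> 's) \<Rightarrow> bool" where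
  "markov_chain_from q x M X \<longleftrightarrow>
     prob_space M \<and>
     (\<forall>n. X n \<in> measurable M (count_space UNIV)) \<and>
     (AE w in M. X 0 w = x) \<and>
     (\<forall>n a. measure M {w \<in> space M. \<forall>i\<le>Suc n. X i w = a i} =
            measure M {w \<in> space M. \<forall>i\<le>n. X i w = a i} * q (a n) (a (Suc n)))"

text \<open>Valued in \<^typ>\<open>enat\<close>, where the infimum of the empty set is \<open>\<infinity>\<close>.\<close>

definition hitting_time :: "(nat \<Rightarrow> 'w \<Rightarrow> 's) \<Rightarrow> 's \<Rightarrow> 'w \<Rightarrow> enat" where
  "hitting_time X x w = (INF n \<in> {n. 1 \<le> n \<and> X n w = x}. enat n)"

text \<open>
  The positivity of \<open>p \<beta> r s\<close> will be assumed not to depend on \<open>\<beta> > 0\<close>, so quantifying over all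
  \<open>\<beta> > 0\<close> merely avoids singling out one of them.
\<close>

definition adjacent :: "(real \<Rightarrow> 's \<Rightarrow> 's \<Rightarrow> real) \<Rightarrow> 's \<Rightarrow> 's \<Rightarrow> bool" where
  "adjacent p r s \<longleftrightarrow> (\<forall>\<beta>>0. p \<beta> r s > 0)"

definition limit_matrix :: "(real \<Rightarrow> 's \<Rightarrow> 's \<Rightarrow> real) \<Rightarrow> 's \<Rightarrow> 's \<Rightarrow> real" where
  "limit_matrix p r s = Lim at_top (\<lambda>\<beta>. p \<beta> r s)"

definition sa_paths :: "(real \<Rightarrow> 's \<Rightarrow> 's \<Rightarrow> real) \<Rightarrow> 's \<Rightarrow> 's \<Rightarrow> 's list set" where
  "sa_paths p r s =
     {g. g \<noteq> [] \<and> hd g = r \<and> last g = s \<and> distinct g \<and> successively (adjacent p) g}"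

definition max_energy :: "('s \<Rightarrow> real) \<Rightarrow> 's list \<Rightarrow> real" where
  "max_energy E g = Max (E ` set g)"

definition minimal_path ::
    "('s \<Rightarrow> real) \<Rightarrow> (real \<Rightarrow> 's \<Rightarrow> 's \<Rightarrow> real) \<Rightarrow> 's \<Rightarrow> 's \<Rightarrow> 's list \<Rightarrow> bool" where
  "minimal_path E p r s g \<longleftrightarrow>
     g \<in> sa_paths p r s \<and> (\<forall>g'\<in>sa_paths p r s. max_energy E g \<le> max_energy E g')"

text \<open>
  All minimal paths have the same maximal energy, so for injective \<open>E\<close> the description below does
  not depend on the choice of the minimal path.
\<close>

definition essential_saddle ::
    "('s \<Rightarrow> real) \<Rightarrow> (real \<Rightarrow> 's \<Rightarrow> 's \<Rightarrow> real) \<Rightarrow> 's \<Rightarrow> 's \<Rightarrow> 's" where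
  "essential_saddle E p r s =
     (THE z. \<exists>g. minimal_path E p r s g \<and> z \<in> set g \<and> E z = max_energy E g)"

text \<open>
  \<open>M \<beta> x\<close> is the law \<open>P\<^sub>x\<close> at inverse temperature \<open>\<beta>\<close> (on an arbitrary sample space), under which
  \<open>X \<beta>\<close> is the chain started at \<open>x\<close>.
\<close>

locale low_temperature_chain =
  fixes E :: "'s::finite \<Rightarrow> real"
    and p :: "real \<Rightarrow> 's \<Rightarrow> 's \<Rightarrow> real"
    and \<pi> :: "real \<Rightarrow> 's \<Rightarrow> real"
    and \<gamma> :: "real \<Rightarrow> real"
    and M :: "real \<Rightarrow> 's \<Rightarrow> 'w measure"
    and X :: "real \<Rightarrow> nat \<Rightarrow> 'w \<Rightarrow> 's"
  assumes energy_inj: "inj E"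
    and stochastic: "\<And>\<beta>. \<beta> > 0 \<Longrightarrow> stochastic (p \<beta>)"
    and chain: "\<And>\<beta> x. \<beta> > 0 \<Longrightarrow> markov_chain_from (p \<beta>) x (M \<beta> x) (X \<beta>)"
    and stationary: "\<And>\<beta>. \<beta> > 0 \<Longrightarrow> stationary_distribution (p \<beta>) (\<pi> \<beta>)"
    and irreducible: "\<And>\<beta>. \<beta> > 0 \<Longrightarrow> irreducible_chain (p \<beta>)"
    and diagonal_pos: "\<And>\<beta> s. \<beta> > 0 \<Longrightarrow> p \<beta> s s > 0"
    and symmetric_pos: "\<And>\<beta> r s. \<beta> > 0 \<Longrightarrow> p \<beta> r s > 0 \<longleftrightarrow> p \<beta> s r > 0"
    and pos_indep: "\<And>\<beta> \<beta>' r s. \<beta> > 0 \<Longrightarrow> \<beta>' > 0 \<Longrightarrow> p \<beta> r s > 0 \<longleftrightarrow> p \<beta>' r s > 0"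
    and gamma_pos: "\<And>\<beta>. \<beta> > 0 \<Longrightarrow> \<gamma> \<beta> > 0"
    and gamma_tendsto: "(\<gamma> \<longlongrightarrow> 0) at_top"
    and beta_gamma: "filterlim (\<lambda>\<beta>. \<beta> * \<gamma> \<beta>) at_top at_top"
    and p_lower: "\<And>\<beta> r s. \<beta> > 0 \<Longrightarrow> r \<noteq> s \<Longrightarrow> p \<beta> r s > 0 \<Longrightarrow>
          exp (- \<beta> * (max 0 (E s - E r) + \<gamma> \<beta> / real CARD('s))) \<le> p \<beta> r s"
    and p_upper: "\<And>\<beta> r s. \<beta> > 0 \<Longrightarrow> r \<noteq> s \<Longrightarrow> p \<beta> r s > 0 \<Longrightarrow>
          p \<beta> r s \<le> exp (- \<beta> * (max 0 (E s - E r) - \<gamma> \<beta> / real CARD('s)))"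
    and limit_exists: "\<And>r s. ((\<lambda>\<beta>. p \<beta> r s) \<longlongrightarrow> limit_matrix p r s) at_top"
    and limit_pos: "\<And>r s. adjacent p r s \<Longrightarrow> E r \<ge> E s \<Longrightarrow> limit_matrix p r s > 0"
    and limit_zero: "\<And>r s. adjacent p r s \<Longrightarrow> E r < E s \<Longrightarrow> limit_matrix p r s = 0"
    and detailed_balance: "\<And>\<beta> r s. \<beta> > 0 \<Longrightarrow> \<pi> \<beta> r * p \<beta> r s = \<pi> \<beta> s * p \<beta> s r"

end

theory Submission
  imports Defs
begin

text \<open>
  Write \<open>H\<^sub>y\<close> and \<open>H\<^sub>z\<close> for the energies of the essential saddles from \<open>x\<close> to \<open>y\<close> and to \<open>z\<close>,
  and read the reversible chain as an electrical network with conductances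
  \<open>c a b = \<pi> \<beta> a * p \<beta> a b\<close>. Let \<open>h a\<close> be the probability that the chain from \<open>a\<close> meets \<open>z\<close> before \<open>y\<close>;
  it is the voltage that is \<open>1\<close> at \<open>z\<close>, \<open>0\<close> at \<open>y\<close> and harmonic elsewhere. The quantity to bound is the
  voltage drop from \<open>x\<close> to \<open>y\<close>, and two facts about the current bound it.

  On the one hand the network can carry only little current from \<open>z\<close> to \<open>y\<close>. The states reachable from \<open>x\<close>
  strictly below the level \<open>H\<^sub>z\<close> form a set containing \<open>y\<close> but not \<open>z\<close> (\<open>basin_separates\<close>). All the current
  crosses its boundary, voltage differences are at most \<open>1\<close>, and so the current is at most the sum of the
  boundary conductances, each at most of order \<open>exp (- \<beta> * H\<^sub>z)\<close>.
  On the other hand a large voltage drop along one edge forces a large current: for an edge from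
  \<open>a\<close> to \<open>b\<close> with \<open>h a > h b\<close>, the level set \<open>{s. h a \<le> h s}\<close> is again a cut between \<open>z\<close> and \<open>y\<close>, all terms of
  the current across it are nonnegative, and one of them is \<open>c a b * (h a - h b)\<close>. Along a minimal path
  from \<open>x\<close> to \<open>y\<close> conductances are at least of order \<open>exp (- \<beta> * H\<^sub>y)\<close>, so every voltage drop along it is at
  most of order \<open>exp (- \<beta> * (H\<^sub>z - H\<^sub>y))\<close>. This is \<open>potential_le_cut_over_path\<close>. Using level sets rather than the
  Dirichlet energy avoids the square root that the Cauchy-Schwarz inequality would introduce.

  The conductances are computed up to factors \<open>exp (3 * \<beta> * \<gamma> \<beta>)\<close> in \<open>conductance_upper\<close> and
  \<open>conductance_lower\<close>: detailed balance along an edge forces \<open>\<pi>\<close> to be close to a Gibbs measure, with an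
  error \<open>exp (2 * \<beta> * \<gamma> \<beta> / CARD('s))\<close> per edge, and at most \<open>CARD('s)\<close> edges are needed to join two states.
  The prefactor \<open>CARD('s) ^ 3\<close> bounds the number of
  boundary edges times the number of edges of the path.
\<close>

section \<open>Self-avoiding paths and the essential saddle\<close>

text \<open>
  If the new state already lies on the path, cutting the path there keeps it self-avoiding. The bound
  on the visited states keeps track of energies: the extension rises no higher than the path and \<open>b\<close>.
\<close>

lemma sa_paths_extend:
  assumes g: "g \<in> sa_paths p r a" and ab: "adjacent p a b"
  shows "\<exists>g'\<in>sa_paths p r b. set g' \<subseteq> insert b (set g)"
proof (cases "b \<in> set g")
  case True
  then obtain us vs where s: "g = us @ b # vs"
    by (auto dest: split_list)
  have "us @ [b] \<in> sa_paths p r b"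
    using g unfolding sa_paths_def s
    by (auto simp: successively_append_iff hd_append split: if_splits)
  then show ?thesis
    using s by (intro bexI[of _ "us @ [b]"]) auto
next
  case False
  then have "g @ [b] \<in> sa_paths p r b"
    using g ab unfolding sa_paths_def by (auto simp: successively_append_iff)
  then show ?thesis
    by (intro bexI[of _ "g @ [b]"]) auto
qed

lemma finite_sa_paths: "finite (sa_paths p r (s :: 's :: finite))"
proof (rule finite_subset)
  show "sa_paths p r s \<subseteq> {g. set g \<subseteq> UNIV \<and> length g \<le> CARD('s)}"
    by (auto simp: sa_paths_def dest!: distinct_card intro: card_mono)
       (metis card_mono finite subset_UNIV)
qed (rule finite_lists_length_le, simp)

lemma length_sa_path_le:
  assumes "g \<in> sa_paths p r (s :: 's :: finite)"
  shows "length g \<le> CARD('s)"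
  using assms distinct_card[of g] card_mono[of UNIV "set g"] by (auto simp: sa_paths_def)

lemma n_step_pos_imp_path:
  assumes "n_step q n r s > 0" "\<And>a b. q a b > 0 \<Longrightarrow> adjacent p a b" "stochastic q"
    and "g \<in> sa_paths p t r"
  shows "sa_paths p t s \<noteq> {}"
  using assms(1,4)
proof (induction n arbitrary: r g)
  case 0
  then show ?case by (auto split: if_splits)
next
  case (Suc n)
  have "\<exists>u. q r u * n_step q n u s > 0"
  proof (rule ccontr)
    assume "\<not> ?thesis"
    then have "(\<Sum>u\<in>UNIV. q r u * n_step q n u s) \<le> 0"
      by (intro sum_nonpos) (auto simp: not_less)
    with Suc.prems show False by simp
  qed
  then obtain u where u: "q r u * n_step q n u s > 0" by blast
  have "q r u \<ge> 0" using assms(3) by (simp add: stochastic_def)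
  with u have "q r u > 0" "n_step q n u s > 0"
    by (auto simp: zero_less_mult_iff)
  with Suc.IH[of u] sa_paths_extend[OF Suc.prems(2)] assms(2) show ?case by blast
qed

text \<open>
  There are only finitely many self-avoiding paths, so a minimal one exists, and injectivity of the
  energy makes its highest state the same for all minimal paths. Hence the definite description in
  \<^const>\<open>essential_saddle\<close> denotes, and only its energy matters below.
\<close>

lemma essential_saddle_energy:
  fixes E :: "'s::finite \<Rightarrow> real"
  assumes "inj E" and ne: "sa_paths p r s \<noteq> {}"
  obtains g where "minimal_path E p r s g"
    and "E (essential_saddle E p r s) = max_energy E g"
proof -
  obtain g where g: "minimal_path E p r s g"
    using ex_min_if_finite[of "max_energy E ` sa_paths p r s"] finite_sa_paths[of p r s] ne
    unfolding minimal_path_def by (metis (no_types, lifting) arg_min_if_finite(1) arg_min_least)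
  have gn: "set g \<noteq> {}" using g by (auto simp: minimal_path_def sa_paths_def)
  have "Max (E ` set g) \<in> E ` set g" using gn by (intro Max_in) auto
  then obtain v where v: "v \<in> set g" "E v = max_energy E g"
    unfolding max_energy_def by auto
  have "essential_saddle E p r s = v"
    unfolding essential_saddle_def
  proof (rule the_equality)
    show "\<exists>g. minimal_path E p r s g \<and> v \<in> set g \<and> E v = max_energy E g"
      using g v by blast
    fix u assume "\<exists>g. minimal_path E p r s g \<and> u \<in> set g \<and> E u = max_energy E g"
    then obtain g' where "minimal_path E p r s g'" "E u = max_energy E g'" by blast
    then have "E u = E v" using g v(2) by (auto simp: minimal_path_def intro: antisym)
    then show "u = v" using assms(1) by (simp add: inj_eq)
  qed
  with g v(2) that show thesis by simp
qed

section \<open>The equilibrium potential and its flow\<close>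

text \<open>
  The probability that the chain started at \<open>a\<close> visits \<open>z\<close> at one of the times \<open>0, \<dots>, n\<close> and does not
  visit \<open>y\<close> earlier. Counting time \<open>0\<close>, unlike in \<^const>\<open>hitting_time\<close>, gives the boundary values
  \<open>1\<close> at \<open>z\<close> and \<open>0\<close> at \<open>y\<close>.
\<close>

primrec hit_within :: "('s::finite \<Rightarrow> 's \<Rightarrow> real) \<Rightarrow> 's \<Rightarrow> 's \<Rightarrow> nat \<Rightarrow> 's \<Rightarrow> real" where
  "hit_within q y z 0 a = (if a = z then 1 else 0)"
| "hit_within q y z (Suc n) a =
     (if a = z then 1 else if a = y then 0 else \<Sum>b\<in>UNIV. q a b * hit_within q y z n b)"

text \<open>
  The probabilities \<^const>\<open>hit_within\<close> increase with the number of steps and stay below \<open>1\<close>; their limit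
  inherits the boundary values, and the recursion turns into harmonicity.
\<close>

lemma equilibrium_potential_exists:
  assumes q: "stochastic q" and "y \<noteq> z"
  obtains h :: "'s::finite \<Rightarrow> real"
  where "h y = 0" "h z = 1" "\<And>a. 0 \<le> h a" "\<And>a. h a \<le> 1"
    "\<And>a. a \<noteq> y \<Longrightarrow> a \<noteq> z \<Longrightarrow> (\<Sum>b\<in>UNIV. q a b * h b) = h a"
proof -
  let ?u = "hit_within q y z"
  have q0: "0 \<le> q a b" and q1: "(\<Sum>b\<in>UNIV. q a b) = 1" for a b
    using q by (auto simp: stochastic_def)
  have u0: "0 \<le> ?u n a" for n a
    by (induction n arbitrary: a) (auto intro!: sum_nonneg mult_nonneg_nonneg q0)
  have u1: "?u n a \<le> 1" for n a
  proof (induction n arbitrary: a)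
    case (Suc n)
    have "(\<Sum>b\<in>UNIV. q a b * ?u n b) \<le> (\<Sum>b\<in>UNIV. q a b * 1)"
      by (intro sum_mono mult_left_mono Suc q0)
    then show ?case by (simp add: q1)
  qed simp
  have mono: "?u n a \<le> ?u (Suc n) a" for n a
  proof (induction n arbitrary: a)
    case 0
    then show ?case by (auto intro!: sum_nonneg mult_nonneg_nonneg q0)
  next
    case (Suc n)
    have "(\<Sum>b\<in>UNIV. q a b * ?u n b) \<le> (\<Sum>b\<in>UNIV. q a b * ?u (Suc n) b)"
      by (intro sum_mono mult_left_mono Suc q0)
    then show ?case by simp
  qed
  define h where "h a = lim (\<lambda>n. ?u n a)" for a
  have lim: "(\<lambda>n. ?u n a) \<longlonglongrightarrow> h a" for a
  proof -
    have "convergent (\<lambda>n. ?u n a)"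
      using mono u0 u1
      by (intro Bseq_monoseq_convergent BseqI'[of _ 1] monoseq_Suc[THEN iffD2] disjI1)
         (simp_all del: hit_within.simps)
    then show ?thesis by (simp add: h_def convergent_LIMSEQ_iff)
  qed
  have limS: "(\<lambda>n. ?u (Suc n) a) \<longlonglongrightarrow> h a" for a
    using lim by (rule LIMSEQ_Suc)
  show thesis
  proof
    show "h y = 0" using limS[of y] \<open>y \<noteq> z\<close> LIMSEQ_unique[OF _ tendsto_const] by auto
    show "h z = 1" using limS[of z] LIMSEQ_unique[OF _ tendsto_const] by auto
    show "0 \<le> h a" for a using LIMSEQ_le_const[OF lim] u0 by blast
    show "h a \<le> 1" for a using LIMSEQ_le_const2[OF lim] u1 by blast
    show "(\<Sum>b\<in>UNIV. q a b * h b) = h a" if "a \<noteq> y" "a \<noteq> z" for a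
    proof (rule LIMSEQ_unique)
      show "(\<lambda>n. \<Sum>b\<in>UNIV. q a b * ?u n b) \<longlonglongrightarrow> (\<Sum>b\<in>UNIV. q a b * h b)"
        by (intro tendsto_intros lim)
      show "(\<lambda>n. \<Sum>b\<in>UNIV. q a b * ?u n b) \<longlonglongrightarrow> h a"
        using limS[of a] that by simp
    qed
  qed
qed

text \<open>
  Conservation of current. The flow \<open>c a b * (h a - h b)\<close> is antisymmetric, so its contributions inside
  \<open>S\<close> cancel and the flow out of \<open>S\<close> is the sum of the divergences at the states of \<open>S\<close>, among which only
  the source \<open>z\<close> contributes.
\<close>

lemma flow_across_cut:
  fixes c :: "'s::finite \<Rightarrow> 's \<Rightarrow> real" and h :: "'s \<Rightarrow> real"
  assumes sym: "\<And>a b. c a b = c b a"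
    and harm: "\<And>a. a \<noteq> y \<Longrightarrow> a \<noteq> z \<Longrightarrow> (\<Sum>b\<in>UNIV. c a b * (h a - h b)) = 0"
    and S: "z \<in> S" "y \<notin> S"
  shows "(\<Sum>a\<in>S. \<Sum>b\<in>-S. c a b * (h a - h b)) = (\<Sum>b\<in>UNIV. c z b * (h z - h b))"
proof -
  let ?f = "\<lambda>a b. c a b * (h a - h b)"
  have "(\<Sum>a\<in>S. \<Sum>b\<in>S. ?f a b) = (\<Sum>b\<in>S. \<Sum>a\<in>S. ?f a b)" by (rule sum.swap)
  also have "\<dots> = - (\<Sum>b\<in>S. \<Sum>a\<in>S. ?f b a)"
    unfolding sum_negf[symmetric]
    by (intro sum.cong refl) (simp add: sym algebra_simps)
  finally have inner: "(\<Sum>a\<in>S. \<Sum>b\<in>S. ?f a b) = 0" by simp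
  have split: "(\<Sum>b\<in>UNIV. ?f a b) = (\<Sum>b\<in>S. ?f a b) + (\<Sum>b\<in>-S. ?f a b)" for a
    using sum.union_disjoint[of S "-S" "?f a"] by (simp add: Compl_partition)
  have "(\<Sum>a\<in>S. \<Sum>b\<in>UNIV. ?f a b) = (\<Sum>a\<in>S. if a = z then \<Sum>b\<in>UNIV. ?f a b else 0)"
    using S by (intro sum.cong refl) (auto intro: harm)
  also have "\<dots> = (\<Sum>b\<in>UNIV. ?f z b)" using S by simp
  finally show ?thesis unfolding split sum.distrib inner by (simp add: split)
qed

text \<open>
  The total current \<open>I\<close> is bounded above through the cut \<open>A\<close>, and it bounds each voltage drop along the path \<open>g\<close>
  through the level set of the upper end of that edge.
\<close>

lemma potential_le_cut_over_path:
  fixes c :: "'s::finite \<Rightarrow> 's \<Rightarrow> real" and h :: "'s \<Rightarrow> real"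
  assumes sym: "\<And>a b. c a b = c b a" and c0: "\<And>a b. 0 \<le> c a b"
    and harm: "\<And>a. a \<noteq> y \<Longrightarrow> a \<noteq> z \<Longrightarrow> (\<Sum>b\<in>UNIV. c a b * (h a - h b)) = 0"
    and h: "h y = 0" "h z = 1" "\<And>a. 0 \<le> h a" "\<And>a. h a \<le> 1"
    and A: "y \<in> A" "z \<notin> A"
    and \<kappa>: "\<kappa> > 0"
    and g: "g \<noteq> []" "last g = y" "successively (\<lambda>a b. \<kappa> \<le> c a b) g"
  shows "h (hd g) \<le> real (length g) * ((\<Sum>a\<in>-A. \<Sum>b\<in>A. c a b) / \<kappa>)"
proof -
  define I where "I = (\<Sum>b\<in>UNIV. c z b * (h z - h b))"
  have flow: "(\<Sum>a\<in>S. \<Sum>b\<in>-S. c a b * (h a - h b)) = I" if "z \<in> S" "y \<notin> S" for S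
    unfolding I_def using sym harm that by (rule flow_across_cut)
  have I0: "0 \<le> I" unfolding I_def using h by (intro sum_nonneg mult_nonneg_nonneg c0) auto
  have "I = (\<Sum>a\<in>-A. \<Sum>b\<in>A. c a b * (h a - h b))"
    using flow[of "-A"] A by simp
  also have "\<dots> \<le> (\<Sum>a\<in>-A. \<Sum>b\<in>A. c a b)"
  proof (intro sum_mono mult_left_le c0)
    show "h a - h b \<le> 1" for a b using h(3)[of b] h(4)[of a] by simp
  qed
  finally have I_le: "I \<le> (\<Sum>a\<in>-A. \<Sum>b\<in>A. c a b)" .
  have edge: "h a - h b \<le> I / \<kappa>" if "\<kappa> \<le> c a b" for a b
  proof (cases "h b < h a")
    case True
    let ?S = "{s. h a \<le> h s}"
    have nonneg: "0 \<le> c u v * (h u - h v)" if "u \<in> ?S" "v \<in> -?S" for u v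
      using that by (intro mult_nonneg_nonneg c0) auto
    \<comment> \<open>The flow out of a superlevel set has no negative terms, so it dominates the flow through one edge.\<close>
    have "\<kappa> * (h a - h b) \<le> c a b * (h a - h b)"
      using True that by (intro mult_right_mono) auto
    also have "\<dots> \<le> (\<Sum>v\<in>-?S. c a v * (h a - h v))"
      using True nonneg by (intro member_le_sum) auto
    also have "\<dots> \<le> (\<Sum>u\<in>?S. \<Sum>v\<in>-?S. c u v * (h u - h v))"
      using nonneg by (intro member_le_sum[of a ?S "\<lambda>u. \<Sum>v\<in>-?S. c u v * (h u - h v)"] sum_nonneg) auto
    also have "\<dots> = I" using True h(3)[of b] by (intro flow) (auto simp: h(1,2,4))
    finally show ?thesis using \<kappa> by (simp add: field_simps)
  next
    case False
    moreover have "0 \<le> I / \<kappa>" using I0 \<kappa> by simp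
    ultimately show ?thesis by linarith
  qed
  have "h (hd g) \<le> real (length g) * (I / \<kappa>)"
    using g
  proof (induction g rule: induct_list012)
    case (2 a)
    then show ?case using h I0 \<kappa> by simp
  next
    case (3 a b g)
    then have "h b \<le> real (length (b # g)) * (I / \<kappa>)" "h a - h b \<le> I / \<kappa>"
      using edge by auto
    then have "h a \<le> I / \<kappa> + real (length (b # g)) * (I / \<kappa>)" by linarith
    also have "\<dots> = real (length (a # b # g)) * (I / \<kappa>)"
      by (simp add: distrib_right del: times_divide_eq_right)
    finally show ?case by simp
  qed simp
  also have "\<dots> \<le> real (length g) * ((\<Sum>a\<in>-A. \<Sum>b\<in>A. c a b) / \<kappa>)"
    using I_le \<kappa> by (intro mult_left_mono divide_right_mono) auto
  finally show ?thesis .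
qed

section \<open>Hitting probabilities and superharmonic functions\<close>

lemma hitting_time_less_imp:
  assumes "hitting_time X z w < hitting_time X y w"
  obtains k where "1 \<le> k" "X k w = z" "\<And>j. 1 \<le> j \<Longrightarrow> j \<le> k \<Longrightarrow> X j w \<noteq> y"
proof -
  obtain k where k: "1 \<le> k" "X k w = z" "enat k < hitting_time X y w"
    using assms unfolding hitting_time_def[of X z] INF_less_iff by auto
  have "X j w \<noteq> y" if "1 \<le> j" "j \<le> k" for j
  proof
    assume "X j w = y"
    then have "hitting_time X y w \<le> enat j"
      unfolding hitting_time_def using that by (intro INF_lower) auto
    also have "\<dots> \<le> enat k" using that by simp
    finally show False using k by simp
  qed
  with k that show thesis by blast
qed

text \<open>
  Optional stopping for the nonnegative supermartingale \<open>h (X n)\<close>, stopped at \<open>y\<close> and \<open>z\<close>, done by hand. The chain is only given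
  by the probabilities of its initial segments from one starting point, so there is no restarted chain
  to appeal to. Instead the induction on the number \<open>m\<close> of remaining steps is over all initial segments
  \<open>a 0, \<dots>, a n\<close> at once: from any such segment, \<open>z\<close> is reached before \<open>y\<close> in \<open>m\<close> further steps with conditional
  probability at most \<open>h (a n)\<close>. One step is split according to the next state \<open>b\<close>.
\<close>

lemma hitting_probability_le_superharmonic:
  assumes mc: "markov_chain_from q x M X"
    and h0: "\<And>a. 0 \<le> h a" and hz: "1 \<le> h z"
    and harm: "\<And>a. a \<noteq> y \<Longrightarrow> a \<noteq> z \<Longrightarrow> (\<Sum>b\<in>UNIV. q a b * h b) \<le> h a"
    and x: "x \<noteq> y" "x \<noteq> z" and "y \<noteq> z"
  shows "measure M {w \<in> space M. hitting_time X z w < hitting_time X y w} \<le> h x"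
proof -
  interpret prob_space M using mc by (simp add: markov_chain_from_def)
  have [measurable]: "X n \<in> measurable M (count_space UNIV)" for n
    using mc by (simp add: markov_chain_from_def)
  have X0: "AE w in M. X 0 w = x"
    and step: "prob {w \<in> space M. \<forall>i\<le>Suc n. X i w = a i} =
       prob {w \<in> space M. \<forall>i\<le>n. X i w = a i} * q (a n) (a (Suc n))" for n a
    using mc by (auto simp: markov_chain_from_def)
  define hit where "hit n m w \<longleftrightarrow>
      (\<exists>k. n < k \<and> k \<le> n + m \<and> X k w = z \<and> (\<forall>j. n < j \<and> j \<le> k \<longrightarrow> X j w \<noteq> y))" for n m w
  have [measurable]: "Measurable.pred M (hit n m)" for n m
    unfolding hit_def by measurable
  have key: "prob {w \<in> space M. (\<forall>i\<le>n. X i w = a i) \<and> hit n m w}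
      \<le> prob {w \<in> space M. \<forall>i\<le>n. X i w = a i} * h (a n)" if "a n \<noteq> y" "a n \<noteq> z" for n m a
    using that
  proof (induction m arbitrary: n a)
    case 0
    have "{w \<in> space M. (\<forall>i\<le>n. X i w = a i) \<and> hit n 0 w} = {}"
      by (auto simp: hit_def)
    then show ?case using h0 by (simp only: measure_empty) simp
  next
    case (Suc m)
    let ?P = "prob {w \<in> space M. \<forall>i\<le>n. X i w = a i}"
    let ?C = "\<lambda>b. {w \<in> space M. \<forall>i\<le>Suc n. X i w = (a(Suc n := b)) i}"
    let ?D = "\<lambda>b. {w \<in> space M. (\<forall>i\<le>Suc n. X i w = (a(Suc n := b)) i) \<and> hit n (Suc m) w}"
    have C: "prob (?C b) = ?P * q (a n) b" for b
      using step[of n "a(Suc n := b)"] by (simp cong: conj_cong)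
    have D: "prob (?D b) \<le> ?P * (q (a n) b * h b)" for b
    proof -
      have Cn: "0 \<le> ?P * q (a n) b" unfolding C[symmetric] by simp
      consider "b = y" | "b = z" | "b \<noteq> y" "b \<noteq> z" by blast
      then show ?thesis
      proof cases
        case 1
        have "\<not> hit n (Suc m) w" if "w \<in> ?C b" for w
        proof
          assume "hit n (Suc m) w"
          then obtain k where "n < k" "\<forall>j. n < j \<and> j \<le> k \<longrightarrow> X j w \<noteq> y"
            unfolding hit_def by blast
          then have "X (Suc n) w \<noteq> y" by auto
          then show False using that 1 by auto
        qed
        then have "?D b = {}" by blast
        then show ?thesis
          using mult_nonneg_nonneg[OF Cn h0[of b]] by (simp only: measure_empty mult.assoc)
      next
        case 2
        have "prob (?D b) \<le> prob (?C b)" by (intro finite_measure_mono) auto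
        also have "\<dots> = ?P * q (a n) b * 1" by (simp only: C mult_1_right)
        also have "\<dots> \<le> ?P * q (a n) b * h b"
          using hz 2 Cn by (intro mult_left_mono) auto
        finally show ?thesis by (simp only: mult.assoc)
      next
        case 3
        have "?D b \<subseteq> {w \<in> space M. (\<forall>i\<le>Suc n. X i w = (a(Suc n := b)) i) \<and> hit (Suc n) m w}"
        proof safe
          fix w assume w: "\<forall>i\<le>Suc n. X i w = (a(Suc n := b)) i" "hit n (Suc m) w"
          then obtain k where k: "n < k" "k \<le> n + Suc m" "X k w = z"
            "\<forall>j. n < j \<and> j \<le> k \<longrightarrow> X j w \<noteq> y" unfolding hit_def by blast
          have "X (Suc n) w = b" using w by auto
          then have "k \<noteq> Suc n" using k 3 by auto
          then show "hit (Suc n) m w" unfolding hit_def using k by (intro exI[of _ k]) auto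
        qed
        then have "prob (?D b) \<le>
            prob {w \<in> space M. (\<forall>i\<le>Suc n. X i w = (a(Suc n := b)) i) \<and> hit (Suc n) m w}"
          by (intro finite_measure_mono) auto
        also have "\<dots> \<le> prob (?C b) * h b"
          using Suc.IH[of "a(Suc n := b)" "Suc n"] 3 by simp
        finally show ?thesis by (simp only: C mult.assoc)
      qed
    qed
    have "{w \<in> space M. (\<forall>i\<le>n. X i w = a i) \<and> hit n (Suc m) w} \<subseteq> (\<Union>b. ?D b)"
      by (auto simp: le_Suc_eq)
    then have "prob {w \<in> space M. (\<forall>i\<le>n. X i w = a i) \<and> hit n (Suc m) w} \<le> prob (\<Union>b. ?D b)"
      by (intro finite_measure_mono) auto
    also have "\<dots> \<le> (\<Sum>b\<in>UNIV. prob (?D b))"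
      by (intro finite_measure_subadditive_finite) auto
    also have "\<dots> \<le> (\<Sum>b\<in>UNIV. ?P * (q (a n) b * h b))" by (intro sum_mono D)
    also have "\<dots> = ?P * (\<Sum>b\<in>UNIV. q (a n) b * h b)" by (simp add: sum_distrib_left)
    also have "\<dots> \<le> ?P * h (a n)" using Suc.prems harm by (intro mult_left_mono) auto
    finally show ?case .
  qed
  have le: "prob {w \<in> space M. hit 0 m w} \<le> h x" for m
  proof -
    have "prob {w \<in> space M. hit 0 m w} = prob {w \<in> space M. (\<forall>i\<le>0. X i w = x) \<and> hit 0 m w}"
      using X0 by (intro finite_measure_eq_AE) auto
    also have "\<dots> \<le> prob {w \<in> space M. \<forall>i\<le>(0::nat). X i w = x} * h x"
      using key[of "\<lambda>_. x" 0 m] x by simp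
    also have "\<dots> \<le> h x" using h0[of x] by (intro mult_left_le_one_le) auto
    finally show ?thesis .
  qed
  have "(\<lambda>m. prob {w \<in> space M. hit 0 m w}) \<longlonglongrightarrow> prob (\<Union>m. {w \<in> space M. hit 0 m w})"
    by (intro finite_Lim_measure_incseq) (auto simp: incseq_def hit_def intro: order_trans)
  then have "prob (\<Union>m. {w \<in> space M. hit 0 m w}) \<le> h x"
    using le by (intro LIMSEQ_le_const2) auto
  moreover have "{w \<in> space M. hitting_time X z w < hitting_time X y w} \<subseteq> (\<Union>m. {w \<in> space M. hit 0 m w})"
  proof safe
    fix w assume w: "w \<in> space M" "hitting_time X z w < hitting_time X y w"
    then obtain k where "1 \<le> k" "X k w = z" "\<And>j. 1 \<le> j \<Longrightarrow> j \<le> k \<Longrightarrow> X j w \<noteq> y"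
      by (auto elim: hitting_time_less_imp)
    then have "hit 0 k w" unfolding hit_def by (intro exI[of _ k]) auto
    with w show "w \<in> (\<Union>m. {w \<in> space M. hit 0 m w})" by auto
  qed
  moreover have "(\<Union>m. {w \<in> space M. hit 0 m w}) \<in> events" by measurable
  ultimately show ?thesis using finite_measure_mono order_trans by blast
qed

section \<open>Conductances of the low temperature chain\<close>

context low_temperature_chain
begin

lemma adjacent_iff: "\<beta> > 0 \<Longrightarrow> adjacent p r s \<longleftrightarrow> p \<beta> r s > 0"
  using pos_indep unfolding adjacent_def by blast

lemma sa_paths_nonempty: "sa_paths p r s \<noteq> {}"
proof -
  obtain n where "n_step (p 1) n r s > 0"
    using irreducible[of 1] by (auto simp: irreducible_chain_def)
  moreover have "[r] \<in> sa_paths p r r" by (simp add: sa_paths_def)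
  ultimately show ?thesis
    using n_step_pos_imp_path stochastic[of 1] adjacent_iff[of 1] by (metis zero_less_one)
qed

text \<open>
  For a Gibbs measure this would be the reciprocal of the partition function, independent of the state.
\<close>

definition weight :: "real \<Rightarrow> 's \<Rightarrow> real" where
  "weight \<beta> a = \<pi> \<beta> a * exp (\<beta> * E a)"

lemma pi_nonneg: "\<beta> > 0 \<Longrightarrow> 0 \<le> \<pi> \<beta> a"
  using stationary[of \<beta>] by (simp add: stationary_distribution_def)

lemma p_nonneg: "\<beta> > 0 \<Longrightarrow> 0 \<le> p \<beta> a b"
  using stochastic[of \<beta>] by (simp add: stochastic_def)

lemma weight_nonneg: "\<beta> > 0 \<Longrightarrow> 0 \<le> weight \<beta> a"
  by (simp add: weight_def pi_nonneg)

text \<open>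
  In the detailed balance equation \<open>\<pi> a / \<pi> b = p b a / p a b\<close> the positive parts of the energy
  difference combine to \<open>exp (- \<beta> * (E a - E b))\<close>, and each of the two transition probabilities costs an error
  \<open>exp (\<beta> * \<gamma> \<beta> / CARD('s))\<close>.
\<close>

lemma weight_adjacent:
  assumes \<beta>: "\<beta> > 0" and ab: "adjacent p a b"
  shows "weight \<beta> a \<le> exp (2 * \<beta> * \<gamma> \<beta> / CARD('s)) * weight \<beta> b"
proof (cases "a = b")
  case True
  have "1 \<le> exp (2 * \<beta> * \<gamma> \<beta> / CARD('s))" using \<beta> gamma_pos[OF \<beta>] by simp
  then show ?thesis using mult_right_mono weight_nonneg[OF \<beta>, of b] True by fastforce
next
  case False
  let ?g = "\<gamma> \<beta> / real CARD('s)" and ?m = "max 0 (E b - E a)" and ?n = "max 0 (E a - E b)"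
  have pos: "p \<beta> a b > 0" "p \<beta> b a > 0" using ab \<beta> adjacent_iff symmetric_pos by auto
  have mn: "?m - ?n = E b - E a" by (simp add: max_def)
  have "\<pi> \<beta> a * exp (- \<beta> * (?m + ?g)) \<le> \<pi> \<beta> a * p \<beta> a b"
    using p_lower[OF \<beta> False pos(1)] pi_nonneg[OF \<beta>] by (intro mult_left_mono)
  also have "\<dots> = \<pi> \<beta> b * p \<beta> b a" using detailed_balance[OF \<beta>] .
  also have "\<dots> \<le> \<pi> \<beta> b * exp (- \<beta> * (?n - ?g))"
    using p_upper[OF \<beta> False[symmetric] pos(2)] pi_nonneg[OF \<beta>] by (intro mult_left_mono)
  finally have "\<pi> \<beta> a * exp (- \<beta> * (?m + ?g)) * exp (\<beta> * (?m + ?g) + \<beta> * E a)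
      \<le> \<pi> \<beta> b * exp (- \<beta> * (?n - ?g)) * exp (\<beta> * (?m + ?g) + \<beta> * E a)"
    by (rule mult_right_mono) simp
  then have "\<pi> \<beta> a * exp (\<beta> * E a)
      \<le> \<pi> \<beta> b * exp (\<beta> * (?m - ?n) + \<beta> * E a + 2 * \<beta> * ?g)"
    unfolding mult.assoc exp_add[symmetric] by (simp add: algebra_simps)
  also have "\<beta> * (?m - ?n) + \<beta> * E a + 2 * \<beta> * ?g = 2 * \<beta> * \<gamma> \<beta> / CARD('s) + \<beta> * E b"
    unfolding mn by (simp add: algebra_simps)
  finally show ?thesis unfolding exp_add by (simp add: weight_def algebra_simps)
qed

text \<open>
  A self-avoiding path has at most \<open>CARD('s)\<close> states, which is why the error allowed per transition is
  divided by this number.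
\<close>

lemma weight_le:
  assumes \<beta>: "\<beta> > 0"
  shows "weight \<beta> a \<le> exp (2 * \<beta> * \<gamma> \<beta>) * weight \<beta> b"
proof -
  define d where "d = 2 * \<beta> * \<gamma> \<beta> / CARD('s)"
  have d: "d > 0" unfolding d_def using \<beta> gamma_pos[OF \<beta>] by simp
  obtain g where g: "g \<in> sa_paths p a b" using sa_paths_nonempty by blast
  then have "g \<noteq> []" "successively (adjacent p) g" "hd g = a" "last g = b"
    by (auto simp: sa_paths_def)
  then have "weight \<beta> (hd g) \<le> exp (d * length g) * weight \<beta> (last g)"
  proof (induction g arbitrary: a rule: induct_list012)
    case (2 u)
    have "1 * weight \<beta> u \<le> exp d * weight \<beta> u"
      using d weight_nonneg[OF \<beta>] by (intro mult_right_mono) auto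
    then show ?case by simp
  next
    case (3 u v g)
    then have "weight \<beta> u \<le> exp d * weight \<beta> v"
      using weight_adjacent[OF \<beta>] by (simp add: d_def)
    also have "\<dots> \<le> exp d * (exp (d * length (v # g)) * weight \<beta> (last (v # g)))"
      using 3 by (intro mult_left_mono) auto
    finally show ?case
      by (simp add: exp_add[symmetric] mult.assoc[symmetric] algebra_simps)
  qed simp
  also have "\<dots> \<le> exp (d * CARD('s)) * weight \<beta> (last g)"
    using length_sa_path_le[OF g] d weight_nonneg[OF \<beta>] by (intro mult_right_mono) auto
  finally show ?thesis using \<open>hd g = a\<close> \<open>last g = b\<close> by (simp add: d_def)
qed

text \<open>
  The weights are comparable, so if one vanished then all would, and \<open>\<pi>\<close> could not have total mass \<open>1\<close>.
\<close>

lemma weight_pos: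
  assumes \<beta>: "\<beta> > 0"
  shows "0 < weight \<beta> b"
proof (rule ccontr)
  assume "\<not> ?thesis"
  then have "weight \<beta> b = 0" using weight_nonneg[OF \<beta>, of b] by linarith
  then have "weight \<beta> a \<le> 0" for a using weight_le[OF \<beta>, of a b] by simp
  then have "\<pi> \<beta> a = 0" for a
    using pi_nonneg[OF \<beta>, of a] by (auto simp: weight_def mult_le_0_iff intro: antisym)
  then show False using stationary[OF \<beta>] by (simp add: stationary_distribution_def)
qed

lemma gamma_div_le: "\<beta> > 0 \<Longrightarrow> \<gamma> \<beta> / CARD('s) \<le> \<gamma> \<beta>"
  using gamma_pos[of \<beta>] by (simp add: divide_le_eq Suc_le_eq)

text \<open>
  The conductance of an edge depends, up to the reference weight at an arbitrary state \<open>x\<close>, only on the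
  higher of its two ends: \<open>exp (- \<beta> * E a)\<close> from the stationary distribution and
  \<open>exp (- \<beta> * max 0 (E b - E a))\<close> from the transition multiply to \<open>exp (- \<beta> * max (E a) (E b))\<close>. Two of the three
  factors \<open>exp (\<beta> * \<gamma> \<beta>)\<close> come from comparing weights and one from the transition probability.
\<close>

lemma conductance_upper:
  assumes \<beta>: "\<beta> > 0" and ab: "a \<noteq> b"
  shows "\<pi> \<beta> a * p \<beta> a b \<le> weight \<beta> x * exp (3 * \<beta> * \<gamma> \<beta>) * exp (- \<beta> * max (E a) (E b))"
proof (cases "p \<beta> a b > 0")
  case True
  have m: "max 0 (E b - E a) = max (E a) (E b) - E a" by (simp add: max_def)
  have "\<beta> * (\<gamma> \<beta> / CARD('s)) \<le> \<beta> * \<gamma> \<beta>"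
    using gamma_div_le[OF \<beta>] \<beta> by (intro mult_left_mono) auto
  then have e: "- \<beta> * (max 0 (E b - E a) - \<gamma> \<beta> / CARD('s)) \<le> \<beta> * E a + \<beta> * \<gamma> \<beta> - \<beta> * max (E a) (E b)"
    unfolding m by (simp add: algebra_simps)
  have "\<pi> \<beta> a * p \<beta> a b \<le> \<pi> \<beta> a * exp (\<beta> * E a + \<beta> * \<gamma> \<beta> - \<beta> * max (E a) (E b))"
    using order_trans[OF p_upper[OF \<beta> ab True] exp_le_cancel_iff[THEN iffD2, OF e]]
      pi_nonneg[OF \<beta>] by (intro mult_left_mono)
  also have "\<dots> = weight \<beta> a * (exp (\<beta> * \<gamma> \<beta>) * exp (- \<beta> * max (E a) (E b)))"
    by (simp add: weight_def exp_add[symmetric] algebra_simps)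
  also have "\<dots> \<le> exp (2 * \<beta> * \<gamma> \<beta>) * weight \<beta> x * (exp (\<beta> * \<gamma> \<beta>) * exp (- \<beta> * max (E a) (E b)))"
    using weight_le[OF \<beta>] by (intro mult_right_mono) auto
  also have "\<dots> = weight \<beta> x * exp (3 * \<beta> * \<gamma> \<beta>) * exp (- \<beta> * max (E a) (E b))"
    by (simp add: exp_add[symmetric] algebra_simps)
  finally show ?thesis .
next
  case False
  then have "p \<beta> a b = 0" using p_nonneg[OF \<beta>, of a b] by linarith
  then show ?thesis using weight_nonneg[OF \<beta>] by simp
qed

lemma conductance_lower:
  assumes \<beta>: "\<beta> > 0" and ab: "a \<noteq> b" "adjacent p a b"
  shows "weight \<beta> x * exp (- 3 * \<beta> * \<gamma> \<beta>) * exp (- \<beta> * max (E a) (E b)) \<le> \<pi> \<beta> a * p \<beta> a b"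
proof -
  have pos: "p \<beta> a b > 0" using ab \<beta> adjacent_iff by auto
  have m: "max 0 (E b - E a) = max (E a) (E b) - E a" by (simp add: max_def)
  have "\<beta> * (\<gamma> \<beta> / CARD('s)) \<le> \<beta> * \<gamma> \<beta>"
    using gamma_div_le[OF \<beta>] \<beta> by (intro mult_left_mono) auto
  then have e: "\<beta> * E a - \<beta> * \<gamma> \<beta> - \<beta> * max (E a) (E b) \<le> - \<beta> * (max 0 (E b - E a) + \<gamma> \<beta> / CARD('s))"
    unfolding m by (simp add: algebra_simps)
  have "weight \<beta> x * exp (- 3 * \<beta> * \<gamma> \<beta>) * exp (- \<beta> * max (E a) (E b))
      \<le> exp (2 * \<beta> * \<gamma> \<beta>) * weight \<beta> a * exp (- 3 * \<beta> * \<gamma> \<beta>) * exp (- \<beta> * max (E a) (E b))"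
    using weight_le[OF \<beta>] by (intro mult_right_mono) auto
  also have "\<dots> = \<pi> \<beta> a * exp (\<beta> * E a - \<beta> * \<gamma> \<beta> - \<beta> * max (E a) (E b))"
    by (simp add: weight_def exp_add[symmetric] algebra_simps)
  also have "\<dots> \<le> \<pi> \<beta> a * p \<beta> a b"
    using order_trans[OF exp_le_cancel_iff[THEN iffD2, OF e] p_lower[OF \<beta> ab(1) pos]]
      pi_nonneg[OF \<beta>] by (intro mult_left_mono)
  finally show ?thesis .
qed

section \<open>The hitting probability\<close>

text \<open>
  The set \<open>A\<close> consists of the states that can be reached from \<open>x\<close> while staying strictly below the level
  \<open>H\<close>. A path leaving it must step onto a state of energy at least \<open>H\<close>, for otherwise that state would belong to it
  as well.
\<close>

lemma basin_separates:
  assumes "E (essential_saddle E p x y) < H" "H \<le> E (essential_saddle E p x z)"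
  obtains A where "y \<in> A" "z \<notin> A"
    "\<And>a b. a \<notin> A \<Longrightarrow> b \<in> A \<Longrightarrow> adjacent p a b \<Longrightarrow> H \<le> E a"
proof
  define A where "A = {a. \<exists>g\<in>sa_paths p x a. \<forall>v\<in>set g. E v < H}"
  have max_less: "max_energy E g < H \<longleftrightarrow> (\<forall>v\<in>set g. E v < H)" if "g \<in> sa_paths p x a" for g a
    using that unfolding max_energy_def sa_paths_def by (subst Max_less_iff) auto
  obtain g where "minimal_path E p x y g" "E (essential_saddle E p x y) = max_energy E g"
    using essential_saddle_energy[OF energy_inj sa_paths_nonempty, of x y] by blast
  then have "g \<in> sa_paths p x y" "max_energy E g < H"
    using assms(1) by (auto simp: minimal_path_def)
  then show "y \<in> A" using max_less unfolding A_def by blast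
  show "z \<notin> A"
  proof
    assume "z \<in> A"
    then obtain g where g: "g \<in> sa_paths p x z" "max_energy E g < H"
      using max_less unfolding A_def by blast
    obtain g' where "minimal_path E p x z g'" "E (essential_saddle E p x z) = max_energy E g'"
      using essential_saddle_energy[OF energy_inj sa_paths_nonempty, of x z] by blast
    then show False using g assms(2) by (auto simp: minimal_path_def)
  qed
  fix a b assume *: "a \<notin> A" "b \<in> A" "adjacent p a b"
  then have "adjacent p b a" using symmetric_pos by (auto simp: adjacent_def)
  obtain g where g: "g \<in> sa_paths p x b" "\<forall>v\<in>set g. E v < H" using * by (auto simp: A_def)
  obtain g' where g': "g' \<in> sa_paths p x a" "set g' \<subseteq> insert a (set g)"
    using sa_paths_extend[OF g(1) \<open>adjacent p b a\<close>] by blast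
  show "H \<le> E a"
  proof (rule ccontr)
    assume "\<not> H \<le> E a"
    then have "\<forall>v\<in>set g'. E v < H" using g g' by auto
    with g' *(1) show False unfolding A_def by blast
  qed
qed

text \<open>
  The unknown weight \<open>W\<close> of \<open>x\<close> enters the conductances of the cut and those of the path alike and
  cancels in their quotient, while the two errors \<open>exp (3 * \<beta> * \<gamma> \<beta>)\<close> add up to the term \<open>6 * \<gamma> \<beta>\<close>.
\<close>

lemma hitting_probability_bound:
  assumes \<beta>: "\<beta> > 0" and xyz: "x \<noteq> y" "x \<noteq> z" "y \<noteq> z"
    and less: "E (essential_saddle E p x y) < E (essential_saddle E p x z)"
  shows "measure (M \<beta> x) {w \<in> space (M \<beta> x). hitting_time (X \<beta>) z w < hitting_time (X \<beta>) y w}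
    \<le> real CARD('s) ^ 3 *
      exp (- \<beta> * (E (essential_saddle E p x z) - E (essential_saddle E p x y) - 6 * \<gamma> \<beta>))"
proof -
  define Hz where "Hz = E (essential_saddle E p x z)"
  define Hy where "Hy = E (essential_saddle E p x y)"
  define N where "N = real CARD('s)"
  define W where "W = weight \<beta> x"
  define c where "c a b = \<pi> \<beta> a * p \<beta> a b" for a b
  have W: "W > 0" unfolding W_def using weight_pos[OF \<beta>] .
  obtain h where h: "h y = 0" "h z = 1" "\<And>a. 0 \<le> h a" "\<And>a. h a \<le> 1"
    and harm: "\<And>a. a \<noteq> y \<Longrightarrow> a \<noteq> z \<Longrightarrow> (\<Sum>b\<in>UNIV. p \<beta> a b * h b) = h a"
    using equilibrium_potential_exists[OF stochastic[OF \<beta>] xyz(3)] by blast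
  have harm_c: "(\<Sum>b\<in>UNIV. c a b * (h a - h b)) = 0" if "a \<noteq> y" "a \<noteq> z" for a
  proof -
    have "(\<Sum>b\<in>UNIV. c a b * (h a - h b))
        = \<pi> \<beta> a * (h a * (\<Sum>b\<in>UNIV. p \<beta> a b) - (\<Sum>b\<in>UNIV. p \<beta> a b * h b))"
      unfolding c_def sum_distrib_left sum_subtractf[symmetric]
      by (intro sum.cong) (auto simp: algebra_simps)
    also have "\<dots> = 0" using stochastic[OF \<beta>] harm[OF that] by (simp add: stochastic_def)
    finally show ?thesis .
  qed
  obtain A where A: "y \<in> A" "z \<notin> A"
    and cut: "\<And>a b. a \<notin> A \<Longrightarrow> b \<in> A \<Longrightarrow> adjacent p a b \<Longrightarrow> Hz \<le> E a"
    using basin_separates[of x y Hz z] less unfolding Hz_def by blast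
  have c_cut: "c a b \<le> W * exp (3 * \<beta> * \<gamma> \<beta>) * exp (- \<beta> * Hz)" if "a \<in> -A" "b \<in> A" for a b
  proof (cases "adjacent p a b")
    case True
    have "c a b \<le> W * exp (3 * \<beta> * \<gamma> \<beta>) * exp (- \<beta> * max (E a) (E b))"
      unfolding c_def W_def using that by (intro conductance_upper \<beta>) auto
    also have "\<dots> \<le> W * exp (3 * \<beta> * \<gamma> \<beta>) * exp (- \<beta> * Hz)"
      using cut[of a b] that True \<beta> W by (intro mult_left_mono) auto
    finally show ?thesis .
  next
    case False
    then have "p \<beta> a b = 0" using p_nonneg[OF \<beta>, of a b] adjacent_iff[OF \<beta>, of a b] by linarith
    then show ?thesis using W by (simp add: c_def)
  qed
  have "(\<Sum>a\<in>-A. \<Sum>b\<in>A. c a b) \<le> (\<Sum>a\<in>-A. \<Sum>b\<in>A. W * exp (3 * \<beta> * \<gamma> \<beta>) * exp (- \<beta> * Hz))"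
    by (intro sum_mono c_cut)
  also have "\<dots> = (real (card (-A)) * real (card A)) * (W * exp (3 * \<beta> * \<gamma> \<beta>) * exp (- \<beta> * Hz))"
    by simp
  also have "\<dots> \<le> (N * N) * (W * exp (3 * \<beta> * \<gamma> \<beta>) * exp (- \<beta> * Hz))"
    unfolding N_def using W by (intro mult_right_mono mult_mono of_nat_mono card_mono) auto
  finally have cut_sum: "(\<Sum>a\<in>-A. \<Sum>b\<in>A. c a b) \<le> (N * N) * (W * exp (3 * \<beta> * \<gamma> \<beta>) * exp (- \<beta> * Hz))" .
  define \<kappa> where "\<kappa> = W * exp (- 3 * \<beta> * \<gamma> \<beta>) * exp (- \<beta> * Hy)"
  have \<kappa>: "\<kappa> > 0" unfolding \<kappa>_def using W by simp
  obtain g where "minimal_path E p x y g" and Hy: "Hy = max_energy E g"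
    using essential_saddle_energy[OF energy_inj sa_paths_nonempty, of x y] unfolding Hy_def by blast
  then have gs: "g \<in> sa_paths p x y" by (simp add: minimal_path_def)
  then have g: "g \<noteq> []" "hd g = x" "last g = y" "distinct g" "successively (adjacent p) g"
    by (auto simp: sa_paths_def)
  have "E v \<le> Hy" if "v \<in> set g" for v using that by (simp add: Hy max_energy_def)
  then have "successively (\<lambda>a b. \<kappa> \<le> c a b) g" using g(4,5)
  proof (induction g rule: induct_list012)
    case (3 a b g)
    have "\<kappa> \<le> W * exp (- 3 * \<beta> * \<gamma> \<beta>) * exp (- \<beta> * max (E a) (E b))"
      unfolding \<kappa>_def using 3(3) \<beta> W by (intro mult_left_mono) auto
    also have "\<dots> \<le> c a b"
      unfolding c_def W_def using 3(4,5) by (intro conductance_lower \<beta>) auto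
    finally show ?case using 3 by simp
  qed auto
  then have "h (hd g) \<le> real (length g) * ((\<Sum>a\<in>-A. \<Sum>b\<in>A. c a b) / \<kappa>)"
    using g A \<kappa> h harm_c detailed_balance[OF \<beta>] pi_nonneg[OF \<beta>] p_nonneg[OF \<beta>]
    by (intro potential_le_cut_over_path[of c y z h]) (auto simp: c_def)
  also have "\<dots> \<le> N * ((N * N) * (W * exp (3 * \<beta> * \<gamma> \<beta>) * exp (- \<beta> * Hz)) / \<kappa>)"
    using cut_sum length_sa_path_le[OF gs] \<kappa> pi_nonneg[OF \<beta>] p_nonneg[OF \<beta>]
    by (intro mult_mono divide_right_mono divide_nonneg_pos sum_nonneg) (auto simp: N_def c_def)
  also have "\<dots> = N ^ 3 * exp (- \<beta> * (Hz - Hy - 6 * \<gamma> \<beta>))"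
  proof -
    have "exp (- \<beta> * (Hz - Hy - 6 * \<gamma> \<beta>)) * \<kappa> = W * exp (3 * \<beta> * \<gamma> \<beta>) * exp (- \<beta> * Hz)"
      unfolding \<kappa>_def by (simp add: exp_add[symmetric] algebra_simps)
    then have "W * exp (3 * \<beta> * \<gamma> \<beta>) * exp (- \<beta> * Hz) / \<kappa> = exp (- \<beta> * (Hz - Hy - 6 * \<gamma> \<beta>))"
      using \<kappa> by (simp add: divide_eq_eq)
    then show ?thesis by (simp only: times_divide_eq_right[symmetric] power3_eq_cube mult.assoc)
  qed
  finally have "h x \<le> N ^ 3 * exp (- \<beta> * (Hz - Hy - 6 * \<gamma> \<beta>))" using g by simp
  moreover have "measure (M \<beta> x) {w \<in> space (M \<beta> x). hitting_time (X \<beta>) z w < hitting_time (X \<beta>) y w} \<le> h x"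
    using h harm xyz by (intro hitting_probability_le_superharmonic[OF chain[OF \<beta>]]) auto
  ultimately show ?thesis unfolding N_def Hz_def Hy_def by linarith
qed

lemma exp_bound_tendsto_0:
  assumes "0 < \<Delta>"
  shows "((\<lambda>\<beta>. exp (- \<beta> * (\<Delta> - k * \<gamma> \<beta>))) \<longlongrightarrow> 0) at_top"
proof -
  have "((\<lambda>\<beta>. \<Delta> - k * \<gamma> \<beta>) \<longlongrightarrow> \<Delta> - k * 0) at_top"
    by (intro tendsto_intros gamma_tendsto)
  then have "filterlim (\<lambda>\<beta>. (\<Delta> - k * \<gamma> \<beta>) * \<beta>) at_top at_top"
    using assms by (intro filterlim_tendsto_pos_mult_at_top[where c = \<Delta>] filterlim_ident) auto
  then have "filterlim (\<lambda>\<beta>. - ((\<Delta> - k * \<gamma> \<beta>) * \<beta>)) at_bot at_top"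
    by (simp add: filterlim_uminus_at_bot)
  then have "((\<lambda>\<beta>. exp (- ((\<Delta> - k * \<gamma> \<beta>) * \<beta>))) \<longlongrightarrow> 0) at_top"
    by (rule filterlim_compose[OF exp_at_bot])
  then show ?thesis by (simp add: mult.commute)
qed

end

theorem theorem2p1:
  fixes E :: "'s::finite \<Rightarrow> real"
    and p :: "real \<Rightarrow> 's \<Rightarrow> 's \<Rightarrow> real"
    and \<pi> :: "real \<Rightarrow> 's \<Rightarrow> real"
    and \<gamma> :: "real \<Rightarrow> real"
    and M :: "real \<Rightarrow> 's \<Rightarrow> 'w measure"
    and X :: "real \<Rightarrow> nat \<Rightarrow> 'w \<Rightarrow> 's"
    and x y z :: 's
  assumes "low_temperature_chain E p \<pi> \<gamma> M X"
    and "x \<noteq> y" and "x \<noteq> z" and "y \<noteq> z"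
    and "E (essential_saddle E p x z) > E (essential_saddle E p x y)"
    and "essential_saddle E p x z \<noteq> x"
  shows "\<exists>K :: real \<Rightarrow> real.
      (\<forall>\<beta>>0. 0 \<le> K \<beta>) \<and>
      bdd_above (K ` {0<..}) \<and>
      (\<forall>\<beta>>0. measure (M \<beta> x) {w \<in> space (M \<beta> x). hitting_time (X \<beta>) z w < hitting_time (X \<beta>) y w}
          \<le> K \<beta> * exp (- \<beta> * (E (essential_saddle E p x z) - E (essential_saddle E p x y) - 7 * \<gamma> \<beta>))) \<and>
      ((\<lambda>\<beta>. K \<beta> * exp (- \<beta> * (E (essential_saddle E p x z) - E (essential_saddle E p x y) - 7 * \<gamma> \<beta>)))
          \<longlongrightarrow> 0) at_top"
proof -
  interpret low_temperature_chain E p \<pi> \<gamma> M X by fact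
  define \<Delta> where "\<Delta> = E (essential_saddle E p x z) - E (essential_saddle E p x y)"
  have \<Delta>: "0 < \<Delta>" using assms(5) by (simp add: \<Delta>_def)
  have "measure (M \<beta> x) {w \<in> space (M \<beta> x). hitting_time (X \<beta>) z w < hitting_time (X \<beta>) y w}
      \<le> real CARD('s) ^ 3 * exp (- \<beta> * (\<Delta> - 7 * \<gamma> \<beta>))" if \<beta>: "\<beta> > 0" for \<beta>
  proof -
    have "exp (- \<beta> * (\<Delta> - 6 * \<gamma> \<beta>)) \<le> exp (- \<beta> * (\<Delta> - 7 * \<gamma> \<beta>))"
      using \<beta> gamma_pos[OF \<beta>] by simp
    then have "real CARD('s) ^ 3 * exp (- \<beta> * (\<Delta> - 6 * \<gamma> \<beta>))
        \<le> real CARD('s) ^ 3 * exp (- \<beta> * (\<Delta> - 7 * \<gamma> \<beta>))"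
      by (rule mult_left_mono) simp
    then show ?thesis
      using hitting_probability_bound[OF \<beta> assms(2-5)] unfolding \<Delta>_def by linarith
  qed
  moreover have "((\<lambda>\<beta>. real CARD('s) ^ 3 * exp (- \<beta> * (\<Delta> - 7 * \<gamma> \<beta>))) \<longlongrightarrow> 0) at_top"
    using exp_bound_tendsto_0[OF \<Delta>, of 7] by (rule tendsto_mult_right_zero)
  ultimately show ?thesis
    unfolding \<Delta>_def by (intro exI[of _ "\<lambda>_. real CARD('s) ^ 3"]) auto
qed

end
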